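(* The discrete fractional differential operator $D_{t_n}^\alpha$ satisfies the following estimates for all $n\in\{1,2,\ldots,N\}$. (1) For $\phi^0,\dots,\phi^N\in L^2(\Omega)$: $\ \frac{1}{2}D_{t_{n}}^{\alpha}\|\phi^{n}\|^{2} \leq \left(D_{t_{n}}^{\alpha}\phi^{n},\phi^{n}\right).$ (2) For $\phi^0,\dots,\phi^N\in L^2(\Omega;\mathbb R^d)$: $$\frac{1}{2}D_{t_{n}}^{\alpha}|||\phi^{n}|||_n^{2} \leq\left(D_{t_{n}}^{\alpha}(\boldsymbol{B}^n\phi^{n}),\phi^{n}\right) - \frac{1}{2} \sum_{j=0}^{n-1} K_{1-\alpha}^{n,j+1}\big(|||\phi^n|||^2_{j+1}-|||\phi^n|||^2_{j}\big).$$ (3) Further, if $\boldsymbol{B}$ is Lipschitz continuous with respect to the time variable with Lipschitz constant $L_B$, then for $\phi^0,\dots,\phi^N\in L^2(\Omega;\mathbb R^d)$: $$\frac{1}{2}D_{t_{n}}^{\alpha}|||\phi^{n}|||_n^{2} \leq\left(D_{t_{n}}^{\alpha}(\boldsymbol{B}^n\phi^{n}),\phi^{n}\right) + \frac{L_B\, t_n^{1-\alpha}}{2\beta_0\Gamma(2-\alpha)}|||\phi^n|||^2_{n}.$$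
   Context: $0<\alpha<1$, $0<T<\infty$, $\Omega\subset\mathbb R^d$ ($d=1,2,3$) is a bounded convex polygonal or polyhedral domain, $(\cdot,\cdot)$ and $\|\cdot\|$ are the $L^2(\Omega)$ inner product and norm (scalar or vector valued). $\boldsymbol B(\boldsymbol x,t)=\boldsymbol A(\boldsymbol x,t)^{-1}$ is a $d\times d$ real symmetric matrix field on $\Omega\times[0,T]$ with $\beta_0\|\boldsymbol y\|^2\le\boldsymbol y^T\boldsymbol B\boldsymbol y\le\gamma_0\|\boldsymbol y\|^2$ for all $\boldsymbol y\in\mathbb R^d$, for constants $\beta_0,\gamma_0>0$. Lipschitz continuity in time with constant $L_B$ means $\|\boldsymbol B(t)-\boldsymbol B(s)\|_{L^\infty(\Omega;\mathbb R^{d\times d})}\le L_B|t-s|$ for all $s,t$ (with the spectral norm on matrices). Time mesh: $t_n=(n/N)^\gamma T$, $0\le n\le N$, $\gamma\ge1$, $\Delta t_j=t_j-t_{j-1}$. $\boldsymbol B^j=\boldsymbol B(\cdot,t_j)$ and $|||\phi|||_j:=\sqrt{(\boldsymbol B^j\phi,\phi)}$. With $k_{1-\alpha}(t)=t^{-\alpha}/\Gamma(1-\alpha)$, set $K_{1-\alpha}^{n,j}=\frac1{\Delta t_j}\int_{t_{j-1}}^{t_j}k_{1-\alpha}(t_n-s)\,ds$. For a sequence $\psi^0,\dots,\psi^N$ (in $\mathbb R$ or a vector space), $D_{t_n}^\alpha\psi^n=\sum_{j=1}^nK_{1-\alpha}^{n,j}(\psi^j-\psi^{j-1})$. Thus $D_{t_n}^\alpha|||\phi^n|||_n^2=\sum_{j=1}^nK_{1-\alpha}^{n,j}(|||\phi^j|||_j^2-|||\phi^{j-1}|||_{j-1}^2)$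 and $D_{t_n}^\alpha(\boldsymbol B^n\phi^n)=\sum_{j=1}^nK_{1-\alpha}^{n,j}(\boldsymbol B^j\phi^j-\boldsymbol B^{j-1}\phi^{j-1})$. *)

theory Defs
  imports "HOL-Analysis.Analysis" "HOL-Probability.Essential_Supremum"
begin

text \<open>For \<open>d = 1, 2, 3\<close> these are the bounded open intervals, the convex polygonal domains
  and the convex polyhedral domains.\<close>

definition convex_polytopal_domain :: "(real^'d) set \<Rightarrow> bool" where
  "convex_polytopal_domain \<Omega> \<longleftrightarrow>
     open \<Omega> \<and> \<Omega> \<noteq> {} \<and> bounded \<Omega> \<and> convex \<Omega> \<and> polytope (closure \<Omega>)"

text \<open>Elements of \<open>L\<^sup>2\<close> are represented by functions, not by classes modulo null sets; the inner
  product and the norms below do not depend on the representative.\<close>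

definition L2_fun :: "(real^'d) set \<Rightarrow> (real^'d \<Rightarrow> 'b::euclidean_space) set" where
  "L2_fun \<Omega> = {f \<in> borel_measurable (lebesgue_on \<Omega>).
                 integrable (lebesgue_on \<Omega>) (\<lambda>x. (norm (f x))\<^sup>2)}"

definition L2_inner :: "(real^'d) set \<Rightarrow> (real^'d \<Rightarrow> 'b::euclidean_space) \<Rightarrow> (real^'d \<Rightarrow> 'b) \<Rightarrow> real" where
  "L2_inner \<Omega> f g = (\<integral>x. f x \<bullet> g x \<partial>lebesgue_on \<Omega>)"

definition L2_norm :: "(real^'d) set \<Rightarrow> (real^'d \<Rightarrow> 'b::euclidean_space) \<Rightarrow> real" where
  "L2_norm \<Omega> f = sqrt (L2_inner \<Omega> f f)"

definition weighted_norm :: "(real^'d) set \<Rightarrow> (real^'d \<Rightarrow> real^'d^'d) \<Rightarrow> (real^'d \<Rightarrow> real^'d) \<Rightarrow> real" where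
  "weighted_norm \<Omega> M \<phi> = sqrt (L2_inner \<Omega> (\<lambda>x. M x *v \<phi> x) \<phi>)"

text \<open>The \<open>L\<^sup>\<infinity>\<close> norm of a matrix field, with the spectral norm (the operator norm for the Euclidean
  norm) on matrices.\<close>

definition Linf_norm :: "(real^'d) set \<Rightarrow> (real^'d \<Rightarrow> real^'d^'d) \<Rightarrow> ereal" where
  "Linf_norm \<Omega> M = esssup (lebesgue_on \<Omega>) (\<lambda>x. ereal (onorm (\<lambda>y. M x *v y)))"

definition lipschitz_in_time ::
  "(real^'d) set \<Rightarrow> real \<Rightarrow> (real^'d \<Rightarrow> real \<Rightarrow> real^'d^'d) \<Rightarrow> real \<Rightarrow> bool" where
  "lipschitz_in_time \<Omega> T B L \<longleftrightarrow>
     (\<forall>s\<in>{0..T}. \<forall>t\<in>{0..T}. Linf_norm \<Omega> (\<lambda>x. B x t - B x s) \<le> ereal (L * \<bar>t - s\<bar>))"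

definition mesh :: "real \<Rightarrow> nat \<Rightarrow> real \<Rightarrow> nat \<Rightarrow> real" where
  "mesh T N \<gamma> n = (real n / real N) powr \<gamma> * T"

text \<open>This is \<open>k\<^bsub>1-\<alpha>\<^esub>\<close>; its value at \<open>0\<close> is \<open>0\<close> by the convention for \<^const>\<open>powr\<close>, which does
  not affect the integrals below.\<close>

definition frac_kernel :: "real \<Rightarrow> real \<Rightarrow> real" where
  "frac_kernel \<alpha> t = t powr (- \<alpha>) / Gamma (1 - \<alpha>)"

definition K_coeff :: "real \<Rightarrow> real \<Rightarrow> nat \<Rightarrow> real \<Rightarrow> nat \<Rightarrow> nat \<Rightarrow> real" where
  "K_coeff \<alpha> T N \<gamma> n j =
     1 / (mesh T N \<gamma> j - mesh T N \<gamma> (j - 1)) *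
     integral {mesh T N \<gamma> (j - 1)..mesh T N \<gamma> j} (\<lambda>s. frac_kernel \<alpha> (mesh T N \<gamma> n - s))"

text \<open>For a sequence of functions on \<open>\<Omega>\<close> this operator is applied pointwise in space.\<close>

definition discr_frac_diff ::
  "real \<Rightarrow> real \<Rightarrow> nat \<Rightarrow> real \<Rightarrow> (nat \<Rightarrow> 'b::real_vector) \<Rightarrow> nat \<Rightarrow> 'b" where
  "discr_frac_diff \<alpha> T N \<gamma> \<psi> n = (\<Sum>j=1..n. K_coeff \<alpha> T N \<gamma> n j *\<^sub>R (\<psi> j - \<psi> (j - 1)))"

end

theory Submission
  imports Defs
begin

text \<open>
  The estimates rest on one fact about the coefficients: for fixed \<open>n\<close> the weights
  \<open>K\<^bsup>n,1\<^esup>, \<dots>, K\<^bsup>n,n\<^esup>\<close> are positive and increase with \<open>j\<close>, because \<open>K\<^bsup>n,j\<^esup>\<close> is a value of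
  \<open>s \<mapsto> k(t\<^sub>n - s)\<close>, an increasing function, at an intermediate point of the \<open>j\<close>-th mesh cell
  (\<open>K_coeff_mean_value\<close>). Summation by parts then gives a discrete maximum principle
  (\<open>discr_frac_diff_nonneg_at_max\<close>): if a real sequence attains its maximum over
  \<open>0, \<dots>, n\<close> at the last index \<open>n\<close>, its discrete fractional derivative there is nonnegative.

  For symmetric positive semidefinite operators \<open>M\<^sub>j\<close>, the sequence
  \<open>a\<^sub>j = 2(M\<^sub>j\<phi>\<^sub>j, \<phi>\<^sub>n) - (M\<^sub>j\<phi>\<^sub>j, \<phi>\<^sub>j) - (M\<^sub>j\<phi>\<^sub>n, \<phi>\<^sub>n)\<close> equals
  \<open>-(M\<^sub>j(\<phi>\<^sub>n - \<phi>\<^sub>j), \<phi>\<^sub>n - \<phi>\<^sub>j)\<close>, so it is at most \<open>0\<close> and vanishes at \<open>j = n\<close>. The maximum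
  principle for \<open>a\<close> is, by linearity of the discrete derivative, the energy estimate
  (\<open>discr_energy_estimate\<close>). With \<open>M\<^sub>j\<close> the identity the last term of \<open>a\<^sub>j\<close> is constant and
  contributes nothing, which gives the first claim; \<open>M\<^sub>j = B\<^sup>j\<close> gives the second.

  The third claim follows from the second by bounding each correction term: almost everywhere
  \<open>\<phi>\<^sub>n \<bullet> (B\<^bsup>j-1\<^esup> - B\<^bsup>j\<^esup>)\<phi>\<^sub>n \<le> L\<^sub>B \<Delta>t\<^sub>j |\<phi>\<^sub>n|\<^sup>2 \<le> (L\<^sub>B \<Delta>t\<^sub>j / \<beta>\<^sub>0) \<phi>\<^sub>n \<bullet> B\<^sup>n\<phi>\<^sub>n\<close>, and the products
  \<open>K\<^bsup>n,j\<^esup> \<Delta>t\<^sub>j\<close> add up to the integral of the kernel over \<open>[0, t\<^sub>n]\<close>, which is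
  \<open>t\<^sub>n\<^bsup>1-\<alpha>\<^esup> / \<Gamma>(2-\<alpha>)\<close> (\<open>sum_K_coeff_increments\<close>).
\<close>

section \<open>The mesh and the kernel weights\<close>

lemma mesh_zero [simp]: "mesh T N \<gamma> 0 = 0"
  by (simp add: mesh_def)

lemma mesh_less:
  assumes "0 < T" "1 \<le> \<gamma>" "0 < N" "i < j"
  shows "mesh T N \<gamma> i < mesh T N \<gamma> j"
  using assms by (auto simp: mesh_def intro!: powr_less_mono2 divide_strict_right_mono)

lemma mesh_le:
  assumes "0 < T" "1 \<le> \<gamma>" "0 < N" "i \<le> j"
  shows "mesh T N \<gamma> i \<le> mesh T N \<gamma> j"
  using mesh_less[OF assms(1-3), of i j] assms(4) by (cases "i = j") auto

lemma mesh_in_time_interval: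
  assumes "0 < T" "1 \<le> \<gamma>" "0 < N" "j \<le> N"
  shows "mesh T N \<gamma> j \<in> {0..T}"
proof -
  have "mesh T N \<gamma> N = T"
    using assms by (simp add: mesh_def)
  then show ?thesis
    using mesh_le[OF assms] mesh_le[OF assms(1-3), of 0 j] by simp
qed

definition frac_kernel_primitive :: "real \<Rightarrow> real \<Rightarrow> real \<Rightarrow> real" where
  "frac_kernel_primitive \<alpha> c s = - ((c - s) powr (1 - \<alpha>)) / Gamma (2 - \<alpha>)"

lemma frac_kernel_primitive_deriv:
  assumes "\<alpha> < 1" "s < c"
  shows "(frac_kernel_primitive \<alpha> c has_real_derivative frac_kernel \<alpha> (c - s)) (at s)"
proof -
  have "1 - \<alpha> \<notin> \<int>\<^sub>\<le>\<^sub>0"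
    using assms by auto
  then have Gamma: "Gamma (2 - \<alpha>) = (1 - \<alpha>) * Gamma (1 - \<alpha>)"
    using Gamma_plus1[of "1 - \<alpha>"] by simp
  have "Gamma (2 - \<alpha>) \<noteq> 0"
    using Gamma_real_pos[of "2 - \<alpha>"] assms by linarith
  then have "(frac_kernel_primitive \<alpha> c has_real_derivative
      (1 - \<alpha>) * (c - s) powr (- \<alpha>) / Gamma (2 - \<alpha>)) (at s)"
    unfolding frac_kernel_primitive_def[abs_def] using assms
    by (auto intro!: derivative_eq_intros simp: field_simps)
  then show ?thesis
    unfolding frac_kernel_def Gamma using assms by simp
qed

lemma frac_kernel_primitive_continuous:
  assumes "\<alpha> < 1" "b \<le> c"
  shows "continuous_on {a..b} (frac_kernel_primitive \<alpha> c)"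
proof -
  have "Gamma (2 - \<alpha>) \<noteq> 0"
    using Gamma_real_pos[of "2 - \<alpha>"] assms by linarith
  then show ?thesis
    unfolding frac_kernel_primitive_def[abs_def] using assms
    by (intro continuous_on_divide continuous_on_minus continuous_on_powr' continuous_intros) auto
qed

text \<open>The cell \<open>j = n\<close> contains the singularity of the kernel at its right end point, so only the
  interior version of the fundamental theorem applies.\<close>

lemma K_coeff_eq_primitive:
  assumes "\<alpha> < 1" "0 < T" "1 \<le> \<gamma>" "0 < N" "j \<le> n"
  shows "K_coeff \<alpha> T N \<gamma> n j =
    (frac_kernel_primitive \<alpha> (mesh T N \<gamma> n) (mesh T N \<gamma> j)
      - frac_kernel_primitive \<alpha> (mesh T N \<gamma> n) (mesh T N \<gamma> (j - 1)))
    / (mesh T N \<gamma> j - mesh T N \<gamma> (j - 1))"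
proof -
  let ?t = "mesh T N \<gamma>" and ?F = "frac_kernel_primitive \<alpha> (mesh T N \<gamma> n)"
  have le: "?t (j - 1) \<le> ?t j" "?t j \<le> ?t n"
    using assms by (auto intro: mesh_le)
  have "((\<lambda>s. frac_kernel \<alpha> (?t n - s)) has_integral (?F (?t j) - ?F (?t (j - 1))))
          {?t (j - 1)..?t j}"
    using le assms
    by (intro fundamental_theorem_of_calculus_interior frac_kernel_primitive_continuous)
      (auto simp: has_real_derivative_iff_has_vector_derivative[symmetric]
        intro!: frac_kernel_primitive_deriv)
  then show ?thesis
    by (simp add: K_coeff_def integral_unique)
qed

text \<open>The coefficient is a difference quotient of the primitive. Comparing successive coefficients
  through the mean value theorem needs no comparison of integrals: the intermediate points of
  successive cells are ordered, and so are the kernel values there. They lie in the interior of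
  the cells, away from the singularity at \<open>t\<^sub>n\<close>.\<close>

lemma K_coeff_mean_value:
  assumes "\<alpha> < 1" "0 < T" "1 \<le> \<gamma>" "0 < N" "1 \<le> j" "j \<le> n"
  obtains \<xi> where "mesh T N \<gamma> (j - 1) < \<xi>" "\<xi> < mesh T N \<gamma> j"
    "K_coeff \<alpha> T N \<gamma> n j = frac_kernel \<alpha> (mesh T N \<gamma> n - \<xi>)"
proof -
  let ?t = "mesh T N \<gamma>" and ?F = "frac_kernel_primitive \<alpha> (mesh T N \<gamma> n)"
  have lt: "?t (j - 1) < ?t j" and le: "?t j \<le> ?t n"
    using assms by (auto intro: mesh_less mesh_le)
  obtain \<xi> where \<xi>: "?t (j - 1) < \<xi>" "\<xi> < ?t j"
    "?F (?t j) - ?F (?t (j - 1)) = frac_kernel \<alpha> (?t n - \<xi>) * (?t j - ?t (j - 1))"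
  proof (rule mvt[OF lt frac_kernel_primitive_continuous[OF assms(1) le]])
    show "(?F has_derivative (*) (frac_kernel \<alpha> (?t n - s))) (at s)" if "s < ?t j" for s
      using frac_kernel_primitive_deriv[OF assms(1), of s "?t n"] that le
      by (simp add: has_field_derivative_def)
  qed
  show thesis
    using that[OF \<xi>(1,2)] \<xi>(3) lt K_coeff_eq_primitive[OF assms(1-4,6)] by simp
qed

lemma frac_kernel_mono:
  assumes "0 < \<alpha>" "\<alpha> < 1" "0 < u" "u \<le> v"
  shows "frac_kernel \<alpha> v \<le> frac_kernel \<alpha> u"
  using assms by (auto simp: frac_kernel_def intro!: divide_right_mono powr_mono2')

lemma K_coeff_nonneg:
  assumes "\<alpha> < 1" "0 < T" "1 \<le> \<gamma>" "0 < N" "1 \<le> j" "j \<le> n"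
  shows "0 \<le> K_coeff \<alpha> T N \<gamma> n j"
  by (rule K_coeff_mean_value[OF assms]) (use assms(1) in \<open>auto simp: frac_kernel_def\<close>)

lemma K_coeff_mono:
  assumes "0 < \<alpha>" "\<alpha> < 1" "0 < T" "1 \<le> \<gamma>" "0 < N" "1 \<le> j" "Suc j \<le> n"
  shows "K_coeff \<alpha> T N \<gamma> n j \<le> K_coeff \<alpha> T N \<gamma> n (Suc j)"
proof -
  obtain \<xi> where \<xi>: "\<xi> < mesh T N \<gamma> j"
    "K_coeff \<alpha> T N \<gamma> n j = frac_kernel \<alpha> (mesh T N \<gamma> n - \<xi>)"
    using K_coeff_mean_value[of \<alpha> T \<gamma> N j n] assms by auto
  obtain \<eta> where \<eta>: "mesh T N \<gamma> j < \<eta>" "\<eta> < mesh T N \<gamma> (Suc j)"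
    "K_coeff \<alpha> T N \<gamma> n (Suc j) = frac_kernel \<alpha> (mesh T N \<gamma> n - \<eta>)"
    using K_coeff_mean_value[of \<alpha> T \<gamma> N "Suc j" n] assms by auto
  have "mesh T N \<gamma> (Suc j) \<le> mesh T N \<gamma> n"
    using assms by (auto intro: mesh_le)
  then show ?thesis
    using \<xi> \<eta> assms by (auto intro!: frac_kernel_mono)
qed

text \<open>The factor \<open>\<Delta>t\<^sub>j\<close> undoes the averaging in the coefficient, so that the sum telescopes. The
  primitive vanishes at \<open>t\<^sub>n\<close>, and only its value at the initial time is left.\<close>

lemma sum_K_coeff_increments:
  assumes "\<alpha> < 1" "0 < T" "1 \<le> \<gamma>" "0 < N"
  shows "(\<Sum>j=1..n. K_coeff \<alpha> T N \<gamma> n j * (mesh T N \<gamma> j - mesh T N \<gamma> (j - 1)))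
    = mesh T N \<gamma> n powr (1 - \<alpha>) / Gamma (2 - \<alpha>)"
proof -
  let ?t = "mesh T N \<gamma>" and ?F = "frac_kernel_primitive \<alpha> (mesh T N \<gamma> n)"
  have "K_coeff \<alpha> T N \<gamma> n j * (?t j - ?t (j - 1)) = ?F (?t j) - ?F (?t (j - 1))"
    if "j \<in> {1..n}" for j
    using K_coeff_eq_primitive[OF assms, of j n] mesh_less[OF assms(2-4), of "j - 1" j] that
    by simp
  then have "(\<Sum>j=1..n. K_coeff \<alpha> T N \<gamma> n j * (?t j - ?t (j - 1)))
    = (\<Sum>j=1..n. ?F (?t j) - ?F (?t (j - 1)))"
    by (rule sum.cong[OF refl])
  also have "\<dots> = ?F (?t n) - ?F (?t 0)"
    using sum_telescope''[of 0 n "\<lambda>j. ?F (?t j)"] by (simp add: atLeastSucAtMost_greaterThanAtMost)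
  finally show ?thesis
    by (simp add: frac_kernel_primitive_def)
qed

section \<open>The discrete fractional derivative at a maximum\<close>

text \<open>The induction needs a bound at every stage \<open>m\<close>, where \<open>b m\<close> need not vanish; the remainder
  \<open>\<kappa> m * b m\<close> is what summation by parts leaves behind at the upper end.\<close>

lemma weighted_increments_ge:
  fixes \<kappa> b :: "nat \<Rightarrow> real"
  assumes "0 \<le> \<kappa> 1"
    and "\<And>j. 1 \<le> j \<Longrightarrow> j < n \<Longrightarrow> \<kappa> j \<le> \<kappa> (Suc j)"
    and "\<And>j. j \<le> n \<Longrightarrow> b j \<le> 0"
    and "1 \<le> m" "m \<le> n"
  shows "\<kappa> m * b m \<le> (\<Sum>j=1..m. \<kappa> j * (b j - b (j - 1)))"
  using assms(4,5)
proof (induction m rule: dec_induct)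
  case base
  then show ?case
    using mult_nonneg_nonpos[OF assms(1) assms(3)[of 0]] by (simp add: algebra_simps)
next
  case (step m)
  have "(\<kappa> (Suc m) - \<kappa> m) * b m \<le> 0"
    using step assms by (intro mult_nonneg_nonpos) auto
  then show ?case
    using step by (simp add: algebra_simps)
qed

lemma discr_frac_diff_nonneg_at_max:
  fixes a :: "nat \<Rightarrow> real"
  assumes "0 < \<alpha>" "\<alpha> < 1" "0 < T" "1 \<le> \<gamma>" "0 < N" "1 \<le> n"
    and max: "\<And>j. j \<le> n \<Longrightarrow> a j \<le> a n"
  shows "0 \<le> discr_frac_diff \<alpha> T N \<gamma> a n"
proof -
  have "K_coeff \<alpha> T N \<gamma> n n * (a n - a n)
    \<le> (\<Sum>j=1..n. K_coeff \<alpha> T N \<gamma> n j * ((a j - a n) - (a (j - 1) - a n)))"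
    by (rule weighted_increments_ge[where b = "\<lambda>j. a j - a n" and n = n])
      (use assms in \<open>auto intro: K_coeff_mono K_coeff_nonneg\<close>)
  then show ?thesis
    by (simp add: discr_frac_diff_def)
qed

lemma discr_frac_diff_minus:
  "discr_frac_diff \<alpha> T N \<gamma> (\<lambda>j. f j - g j) n
    = discr_frac_diff \<alpha> T N \<gamma> f n - discr_frac_diff \<alpha> T N \<gamma> g n"
  by (simp add: discr_frac_diff_def sum_subtractf[symmetric] algebra_simps)

lemma discr_frac_diff_scaleR:
  "discr_frac_diff \<alpha> T N \<gamma> (\<lambda>j. c *\<^sub>R f j) n = c *\<^sub>R discr_frac_diff \<alpha> T N \<gamma> f n"
  by (simp add: discr_frac_diff_def scaleR_sum_right algebra_simps)

lemma discr_frac_diff_cong: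
  assumes "\<And>j. j \<le> n \<Longrightarrow> f j = g j"
  shows "discr_frac_diff \<alpha> T N \<gamma> f n = discr_frac_diff \<alpha> T N \<gamma> g n"
  unfolding discr_frac_diff_def by (rule sum.cong) (use assms in auto)

section \<open>The energy estimate for symmetric positive semidefinite fields\<close>

lemma L2_inner_discr_frac_diff:
  fixes \<psi> :: "nat \<Rightarrow> real^'d \<Rightarrow> 'b::euclidean_space"
  assumes int: "\<And>j. j \<le> n \<Longrightarrow> integrable (lebesgue_on \<Omega>) (\<lambda>x. \<psi> j x \<bullet> \<phi> x)"
  shows "L2_inner \<Omega> (\<lambda>x. discr_frac_diff \<alpha> T N \<gamma> (\<lambda>j. \<psi> j x) n) \<phi>
    = discr_frac_diff \<alpha> T N \<gamma> (\<lambda>j. L2_inner \<Omega> (\<psi> j) \<phi>) n"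
proof -
  have "L2_inner \<Omega> (\<lambda>x. discr_frac_diff \<alpha> T N \<gamma> (\<lambda>j. \<psi> j x) n) \<phi>
    = (\<integral>x. (\<Sum>j=1..n. K_coeff \<alpha> T N \<gamma> n j * (\<psi> j x \<bullet> \<phi> x - \<psi> (j - 1) x \<bullet> \<phi> x)) \<partial>lebesgue_on \<Omega>)"
    by (simp add: L2_inner_def discr_frac_diff_def inner_sum_left inner_diff_left)
  also have "\<dots> = (\<Sum>j=1..n. \<integral>x. K_coeff \<alpha> T N \<gamma> n j * (\<psi> j x \<bullet> \<phi> x - \<psi> (j - 1) x \<bullet> \<phi> x) \<partial>lebesgue_on \<Omega>)"
    by (rule Bochner_Integration.integral_sum) (use int in auto)
  also have "\<dots> = discr_frac_diff \<alpha> T N \<gamma> (\<lambda>j. L2_inner \<Omega> (\<psi> j) \<phi>) n"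
    unfolding discr_frac_diff_def L2_inner_def
    by (rule sum.cong) (use int in auto)
  finally show ?thesis .
qed

text \<open>The discrete form of \<open>1/2 D(M\<phi>, \<phi>) \<le> (D(M\<phi>), \<phi>) - 1/2 (DM \<phi>, \<phi>)\<close>. The operators are kept
  abstract so that scalar functions with the identity and vector fields with the matrices \<open>B\<^sup>j\<close>
  are both instances.\<close>

lemma discr_energy_estimate:
  fixes M :: "nat \<Rightarrow> real^'d \<Rightarrow> 'b::euclidean_space \<Rightarrow> 'b"
  assumes params: "0 < \<alpha>" "\<alpha> < 1" "0 < T" "1 \<le> \<gamma>" "0 < N" "1 \<le> n"
    and lin: "\<And>j x. j \<le> n \<Longrightarrow> x \<in> \<Omega> \<Longrightarrow> linear (M j x)"
    and sym: "\<And>j x u v. j \<le> n \<Longrightarrow> x \<in> \<Omega> \<Longrightarrow> M j x u \<bullet> v = M j x v \<bullet> u"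
    and psd: "\<And>j x u. j \<le> n \<Longrightarrow> x \<in> \<Omega> \<Longrightarrow> 0 \<le> M j x u \<bullet> u"
    and int: "\<And>i j k. i \<le> n \<Longrightarrow> j \<le> n \<Longrightarrow> k \<le> n \<Longrightarrow>
      integrable (lebesgue_on \<Omega>) (\<lambda>x. M j x (\<phi> i x) \<bullet> \<phi> k x)"
  shows "1/2 * discr_frac_diff \<alpha> T N \<gamma> (\<lambda>j. L2_inner \<Omega> (\<lambda>x. M j x (\<phi> j x)) (\<phi> j)) n
    \<le> L2_inner \<Omega> (\<lambda>x. discr_frac_diff \<alpha> T N \<gamma> (\<lambda>j. M j x (\<phi> j x)) n) (\<phi> n)
      - 1/2 * discr_frac_diff \<alpha> T N \<gamma> (\<lambda>j. L2_inner \<Omega> (\<lambda>x. M j x (\<phi> n x)) (\<phi> n)) n"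
proof -
  let ?D = "\<lambda>f. discr_frac_diff \<alpha> T N \<gamma> f n"
  define P where "P j = L2_inner \<Omega> (\<lambda>x. M j x (\<phi> j x)) (\<phi> j)" for j
  define Q where "Q j = L2_inner \<Omega> (\<lambda>x. M j x (\<phi> j x)) (\<phi> n)" for j
  define R where "R j = L2_inner \<Omega> (\<lambda>x. M j x (\<phi> n x)) (\<phi> n)" for j
  \<comment> \<open>Equality holds at \<open>j = n\<close>, so \<open>2 Q - P - R\<close> attains its maximum there.\<close>
  have cross_le: "2 * Q j \<le> P j + R j" if j: "j \<le> n" for j
  proof -
    have "(\<integral>x. 2 * (M j x (\<phi> j x) \<bullet> \<phi> n x) \<partial>lebesgue_on \<Omega>)
      \<le> (\<integral>x. M j x (\<phi> j x) \<bullet> \<phi> j x + M j x (\<phi> n x) \<bullet> \<phi> n x \<partial>lebesgue_on \<Omega>)"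
    proof (rule integral_mono)
      fix x assume "x \<in> space (lebesgue_on \<Omega>)"
      then have x: "x \<in> \<Omega>"
        by (simp add: space_restrict_space)
      have "0 \<le> M j x (\<phi> n x - \<phi> j x) \<bullet> (\<phi> n x - \<phi> j x)"
        by (rule psd[OF j x])
      then show "2 * (M j x (\<phi> j x) \<bullet> \<phi> n x) \<le> M j x (\<phi> j x) \<bullet> \<phi> j x + M j x (\<phi> n x) \<bullet> \<phi> n x"
        using sym[OF j x, of "\<phi> j x" "\<phi> n x"] linear_diff[OF lin[OF j x], of "\<phi> n x" "\<phi> j x"]
        by (simp add: inner_diff_left inner_diff_right)
    qed (use int j in auto)
    then show ?thesis
      using int j by (simp add: P_def Q_def R_def L2_inner_def)
  qed
  have "2 *\<^sub>R Q j - P j - R j \<le> 2 *\<^sub>R Q n - P n - R n" if "j \<le> n" for j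
    using cross_le[OF that] by (simp add: P_def Q_def R_def)
  then have "0 \<le> ?D (\<lambda>j. 2 *\<^sub>R Q j - P j - R j)"
    by (rule discr_frac_diff_nonneg_at_max[OF params])
  also have "\<dots> = 2 * ?D Q - ?D P - ?D R"
    by (simp only: discr_frac_diff_minus discr_frac_diff_scaleR) simp
  finally show ?thesis
    using L2_inner_discr_frac_diff[where n = n and \<psi> = "\<lambda>j x. M j x (\<phi> j x)" and \<phi> = "\<phi> n"] int
    by (simp add: Q_def[abs_def] P_def[abs_def] R_def[abs_def])
qed

section \<open>Square-integrable vector fields and bounded matrix fields\<close>

lemma symmetric_matrix_inner:
  fixes M :: "real^'d^'d"
  assumes "transpose M = M"
  shows "(M *v u) \<bullet> v = (M *v v) \<bullet> u"
  by (metis assms dot_lmul_matrix inner_commute vector_transpose_matrix)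

text \<open>Polarization: the bilinear form is a difference of two quadratic forms, each of which lies
  between \<open>0\<close> and its upper bound. Thus a bound on
  the diagonal is enough to make the form integrable on pairs of square-integrable fields.\<close>

lemma symmetric_psd_form_bound:
  fixes M :: "real^'d^'d"
  assumes sym: "transpose M = M"
    and bounds: "\<And>y. 0 \<le> y \<bullet> (M *v y)" "\<And>y. y \<bullet> (M *v y) \<le> c * (norm y)\<^sup>2"
  shows "\<bar>(M *v u) \<bullet> v\<bar> \<le> c * ((norm u)\<^sup>2 + (norm v)\<^sup>2)"
proof -
  have polar: "4 * ((M *v u) \<bullet> v) = (u + v) \<bullet> (M *v (u + v)) - (u - v) \<bullet> (M *v (u - v))"
    using symmetric_matrix_inner[OF sym, of u v]
    by (simp add: matrix_vector_right_distrib matrix_vector_mult_diff_distrib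
        inner_add_left inner_add_right inner_diff_left inner_diff_right inner_commute)
  have para: "c * (norm (u + v))\<^sup>2 + c * (norm (u - v))\<^sup>2 = 2 * (c * ((norm u)\<^sup>2 + (norm v)\<^sup>2))"
    by (simp add: power2_norm_eq_inner inner_add_left inner_add_right inner_diff_left
        inner_diff_right inner_commute algebra_simps)
  show ?thesis
    using polar para bounds(1)[of "u + v"] bounds(1)[of "u - v"]
      bounds(2)[of "u + v"] bounds(2)[of "u - v"]
    by linarith
qed

lemma borel_measurable_matrix_vector_mult:
  fixes M :: "'x \<Rightarrow> real^'d^'d"
  assumes "M \<in> borel_measurable S" "f \<in> borel_measurable S"
  shows "(\<lambda>x. M x *v f x) \<in> borel_measurable S"
proof (rule borel_measurable_continuous_Pair[OF assms])
  show "continuous_on UNIV (\<lambda>p :: (real^'d^'d) \<times> (real^'d). fst p *v snd p)"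
    unfolding matrix_vector_mult_def by (intro continuous_intros)
qed

lemma integrable_symmetric_psd_form:
  fixes M :: "real^'d \<Rightarrow> real^'d^'d"
  assumes M: "M \<in> borel_measurable (lebesgue_on \<Omega>)"
    and sym: "\<And>x. x \<in> \<Omega> \<Longrightarrow> transpose (M x) = M x"
    and bounds: "\<And>x y. x \<in> \<Omega> \<Longrightarrow> 0 \<le> y \<bullet> (M x *v y)"
      "\<And>x y. x \<in> \<Omega> \<Longrightarrow> y \<bullet> (M x *v y) \<le> c * (norm y)\<^sup>2"
    and f: "f \<in> L2_fun \<Omega>" and g: "g \<in> L2_fun \<Omega>"
  shows "integrable (lebesgue_on \<Omega>) (\<lambda>x. (M x *v f x) \<bullet> g x)"
proof (rule Bochner_Integration.integrable_bound)
  show "integrable (lebesgue_on \<Omega>) (\<lambda>x. c * ((norm (f x))\<^sup>2 + (norm (g x))\<^sup>2))"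
    using f g by (auto simp: L2_fun_def)
  show "(\<lambda>x. (M x *v f x) \<bullet> g x) \<in> borel_measurable (lebesgue_on \<Omega>)"
    using f g M
    by (auto simp: L2_fun_def intro!: borel_measurable_inner borel_measurable_matrix_vector_mult)
  have "\<bar>(M x *v f x) \<bullet> g x\<bar> \<le> c * ((norm (f x))\<^sup>2 + (norm (g x))\<^sup>2)" if "x \<in> \<Omega>" for x
    using symmetric_psd_form_bound[OF sym bounds] that by blast
  then show "AE x in lebesgue_on \<Omega>. norm ((M x *v f x) \<bullet> g x)
      \<le> norm (c * ((norm (f x))\<^sup>2 + (norm (g x))\<^sup>2))"
    by (intro AE_I2) (force simp: space_restrict_space)
qed

lemma integrable_inner_L2_fun:
  assumes f: "f \<in> L2_fun \<Omega>" and g: "g \<in> L2_fun \<Omega>"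
  shows "integrable (lebesgue_on \<Omega>) (\<lambda>x. f x \<bullet> g x)"
proof (rule Bochner_Integration.integrable_bound)
  show "integrable (lebesgue_on \<Omega>) (\<lambda>x. (norm (f x))\<^sup>2 + (norm (g x))\<^sup>2)"
    using f g by (auto simp: L2_fun_def)
  show "(\<lambda>x. f x \<bullet> g x) \<in> borel_measurable (lebesgue_on \<Omega>)"
    using f g by (auto simp: L2_fun_def)
  have "\<bar>u \<bullet> v\<bar> \<le> (norm u)\<^sup>2 + (norm v)\<^sup>2" for u v :: 'b
  proof -
    have "2 * (norm u * norm v) \<le> (norm u)\<^sup>2 + (norm v)\<^sup>2"
      using sum_squares_bound[of "norm u" "norm v"] by simp
    moreover have "0 \<le> norm u * norm v"
      by simp
    ultimately show ?thesis
      using Cauchy_Schwarz_ineq2[of u v] by linarith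
  qed
  then show "AE x in lebesgue_on \<Omega>. norm (f x \<bullet> g x) \<le> norm ((norm (f x))\<^sup>2 + (norm (g x))\<^sup>2)"
    by (intro AE_I2) force
qed

lemma L2_norm_sq: "(L2_norm \<Omega> f)\<^sup>2 = L2_inner \<Omega> f f"
  by (simp add: L2_norm_def L2_inner_def)

text \<open>Semidefiniteness is essential: the real square root of a negative number is negative, and
  its square has the wrong sign.\<close>

lemma weighted_norm_sq:
  assumes "\<And>x y. x \<in> \<Omega> \<Longrightarrow> 0 \<le> y \<bullet> (M x *v y)"
  shows "(weighted_norm \<Omega> M \<phi>)\<^sup>2 = L2_inner \<Omega> (\<lambda>x. M x *v \<phi> x) \<phi>"
proof -
  have "0 \<le> L2_inner \<Omega> (\<lambda>x. M x *v \<phi> x) \<phi>"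
    unfolding L2_inner_def
    by (rule Bochner_Integration.integral_nonneg) (use assms in \<open>auto simp: space_restrict_space inner_commute\<close>)
  then show ?thesis
    by (simp add: weighted_norm_def)
qed

text \<open>The comparison with the form of \<open>M\<close> is made at almost every point rather than after
  integration. At such a point \<open>c\<close> dominates an operator norm, hence is nonnegative, which is
  what multiplying the coercivity bound by \<open>c / \<beta>\<close> requires.\<close>

lemma L2_inner_diff_le_weighted:
  fixes P Q M :: "real^'d \<Rightarrow> real^'d^'d"
  assumes norm: "Linf_norm \<Omega> (\<lambda>x. P x - Q x) \<le> ereal c"
    and coercive: "\<And>x y. x \<in> \<Omega> \<Longrightarrow> \<beta> * (norm y)\<^sup>2 \<le> y \<bullet> (M x *v y)" and "0 < \<beta>"
    and int: "integrable (lebesgue_on \<Omega>) (\<lambda>x. (P x *v \<phi> x) \<bullet> \<phi> x)"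
      "integrable (lebesgue_on \<Omega>) (\<lambda>x. (Q x *v \<phi> x) \<bullet> \<phi> x)"
      "integrable (lebesgue_on \<Omega>) (\<lambda>x. (M x *v \<phi> x) \<bullet> \<phi> x)"
  shows "L2_inner \<Omega> (\<lambda>x. Q x *v \<phi> x) \<phi> - L2_inner \<Omega> (\<lambda>x. P x *v \<phi> x) \<phi>
    \<le> c / \<beta> * L2_inner \<Omega> (\<lambda>x. M x *v \<phi> x) \<phi>"
proof -
  have "AE x in lebesgue_on \<Omega>. ereal (onorm (\<lambda>y. (P x - Q x) *v y)) \<le> Linf_norm \<Omega> (\<lambda>x. P x - Q x)"
    (* The bound holds also for a non-measurable field, whose essential supremum is infinite. *)
    unfolding Linf_norm_def by (rule esssup_AE)
  moreover have "AE x in lebesgue_on \<Omega>. x \<in> \<Omega>"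
    by (intro AE_I2) (simp add: space_restrict_space)
  ultimately have "AE x in lebesgue_on \<Omega>.
    (Q x *v \<phi> x) \<bullet> \<phi> x - (P x *v \<phi> x) \<bullet> \<phi> x \<le> c / \<beta> * ((M x *v \<phi> x) \<bullet> \<phi> x)"
  proof eventually_elim
    case (elim x)
    let ?R = "P x - Q x" and ?y = "\<phi> x"
    have bl: "bounded_linear ((*v) ?R)"
      by (rule matrix_vector_mul_bounded_linear)
    have "ereal (onorm ((*v) ?R)) \<le> ereal c"
      using elim(1) norm by (rule order_trans)
    then have c: "onorm ((*v) ?R) \<le> c"
      by simp
    then have "0 \<le> c"
      using onorm_pos_le[OF bl] by linarith
    have "(Q x *v ?y) \<bullet> ?y - (P x *v ?y) \<bullet> ?y = - ((?R *v ?y) \<bullet> ?y)"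
      by (simp add: matrix_vector_mult_diff_rdistrib inner_diff_left)
    also have "\<dots> \<le> norm (?R *v ?y) * norm ?y"
      using Cauchy_Schwarz_ineq2[of "?R *v ?y" ?y] by linarith
    also have "\<dots> \<le> (c * norm ?y) * norm ?y"
      using onorm[OF bl, of ?y] mult_right_mono[OF c, of "norm ?y"]
      by (intro mult_right_mono) auto
    also have "\<dots> = c / \<beta> * (\<beta> * (norm ?y)\<^sup>2)"
      using \<open>0 < \<beta>\<close> by (simp add: power2_eq_square)
    also have "\<dots> \<le> c / \<beta> * ((M x *v ?y) \<bullet> ?y)"
      using coercive[OF elim(2), of ?y] \<open>0 \<le> c\<close> \<open>0 < \<beta>\<close>
      by (intro mult_left_mono) (auto simp: inner_commute)
    finally show ?case .
  qed
  then have "(\<integral>x. (Q x *v \<phi> x) \<bullet> \<phi> x - (P x *v \<phi> x) \<bullet> \<phi> x \<partial>lebesgue_on \<Omega>)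
    \<le> (\<integral>x. c / \<beta> * ((M x *v \<phi> x) \<bullet> \<phi> x) \<partial>lebesgue_on \<Omega>)"
    using int by (intro integral_mono_AE) auto
  then show ?thesis
    using int by (simp add: L2_inner_def)
qed

section \<open>The three estimates\<close>

theorem lemma3p1:
  fixes \<alpha> T \<gamma> \<beta>\<^sub>0 \<gamma>\<^sub>0 :: real and N :: nat
    and \<Omega> :: "(real^'d) set"
    and A B :: "real^'d \<Rightarrow> real \<Rightarrow> real^'d^'d"
  defines "t \<equiv> mesh T N \<gamma>"
    and "K \<equiv> K_coeff \<alpha> T N \<gamma>"
  assumes alpha: "0 < \<alpha>" "\<alpha> < 1"
    and T: "0 < T"
    and gamma: "1 \<le> \<gamma>"
    and dim: "CARD('d) \<in> {1, 2, 3}"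
    and Omega: "convex_polytopal_domain \<Omega>"
    and B_inverse: "\<And>x s. x \<in> \<Omega> \<Longrightarrow> s \<in> {0..T} \<Longrightarrow> invertible (A x s) \<and> B x s = matrix_inv (A x s)"
    and B_measurable: "\<And>s. s \<in> {0..T} \<Longrightarrow> (\<lambda>x. B x s) \<in> borel_measurable (lebesgue_on \<Omega>)"
    and B_symmetric: "\<And>x s. x \<in> \<Omega> \<Longrightarrow> s \<in> {0..T} \<Longrightarrow> transpose (B x s) = B x s"
    and B_bounds_pos: "0 < \<beta>\<^sub>0" "0 < \<gamma>\<^sub>0"
    and B_bounds: "\<And>x s y. x \<in> \<Omega> \<Longrightarrow> s \<in> {0..T} \<Longrightarrow>
          \<beta>\<^sub>0 * (norm y)\<^sup>2 \<le> y \<bullet> (B x s *v y) \<and> y \<bullet> (B x s *v y) \<le> \<gamma>\<^sub>0 * (norm y)\<^sup>2"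
  shows "\<forall>n\<in>{1..N}.
     (\<forall>\<phi> :: nat \<Rightarrow> real^'d \<Rightarrow> real. (\<forall>j\<le>N. \<phi> j \<in> L2_fun \<Omega>) \<longrightarrow>
        1/2 * discr_frac_diff \<alpha> T N \<gamma> (\<lambda>j. (L2_norm \<Omega> (\<phi> j))\<^sup>2) n
        \<le> L2_inner \<Omega> (\<lambda>x. discr_frac_diff \<alpha> T N \<gamma> (\<lambda>j. \<phi> j x) n) (\<phi> n)) \<and>
     (\<forall>\<phi> :: nat \<Rightarrow> real^'d \<Rightarrow> real^'d. (\<forall>j\<le>N. \<phi> j \<in> L2_fun \<Omega>) \<longrightarrow>
        1/2 * discr_frac_diff \<alpha> T N \<gamma> (\<lambda>j. (weighted_norm \<Omega> (\<lambda>x. B x (t j)) (\<phi> j))\<^sup>2) n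
        \<le> L2_inner \<Omega> (\<lambda>x. discr_frac_diff \<alpha> T N \<gamma> (\<lambda>j. B x (t j) *v \<phi> j x) n) (\<phi> n)
          - 1/2 * (\<Sum>j=0..n-1. K n (j + 1) *
              ((weighted_norm \<Omega> (\<lambda>x. B x (t (j + 1))) (\<phi> n))\<^sup>2
               - (weighted_norm \<Omega> (\<lambda>x. B x (t j)) (\<phi> n))\<^sup>2))) \<and>
     (\<forall>L\<^sub>B. lipschitz_in_time \<Omega> T B L\<^sub>B \<longrightarrow>
       (\<forall>\<phi> :: nat \<Rightarrow> real^'d \<Rightarrow> real^'d. (\<forall>j\<le>N. \<phi> j \<in> L2_fun \<Omega>) \<longrightarrow>
        1/2 * discr_frac_diff \<alpha> T N \<gamma> (\<lambda>j. (weighted_norm \<Omega> (\<lambda>x. B x (t j)) (\<phi> j))\<^sup>2) n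
        \<le> L2_inner \<Omega> (\<lambda>x. discr_frac_diff \<alpha> T N \<gamma> (\<lambda>j. B x (t j) *v \<phi> j x) n) (\<phi> n)
          + L\<^sub>B * t n powr (1 - \<alpha>) / (2 * \<beta>\<^sub>0 * Gamma (2 - \<alpha>))
            * (weighted_norm \<Omega> (\<lambda>x. B x (t n)) (\<phi> n))\<^sup>2))"
proof (intro ballI)
  fix n assume "n \<in> {1..N}"
  then have n: "1 \<le> n" "n \<le> N" and N: "0 < N"
    by auto
  note params = alpha T gamma N n(1)
  have t: "t j \<in> {0..T}" if "j \<le> n" for j
    unfolding t_def using that n by (intro mesh_in_time_interval[OF T gamma N]) simp
  have nonneg: "0 \<le> y \<bullet> (B x (t j) *v y)" if "x \<in> \<Omega>" "j \<le> n" for x y j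
  proof -
    have "0 \<le> \<beta>\<^sub>0 * (norm y)\<^sup>2"
      using B_bounds_pos by simp
    then show ?thesis
      using B_bounds[OF that(1) t[OF that(2)], of y] by linarith
  qed
  have wn: "(weighted_norm \<Omega> (\<lambda>x. B x (t j)) \<psi>)\<^sup>2 = L2_inner \<Omega> (\<lambda>x. B x (t j) *v \<psi> x) \<psi>"
    if "j \<le> n" for j \<psi>
    using nonneg that by (intro weighted_norm_sq) auto
  have int: "integrable (lebesgue_on \<Omega>) (\<lambda>x. (B x (t j) *v f x) \<bullet> g x)"
    if "j \<le> n" "f \<in> L2_fun \<Omega>" "g \<in> L2_fun \<Omega>" for j f g
    using nonneg t that B_bounds B_symmetric B_measurable
    by (intro integrable_symmetric_psd_form[where c = \<gamma>\<^sub>0]) auto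

  have scalar: "1/2 * discr_frac_diff \<alpha> T N \<gamma> (\<lambda>j. (L2_norm \<Omega> (\<phi> j))\<^sup>2) n
      \<le> L2_inner \<Omega> (\<lambda>x. discr_frac_diff \<alpha> T N \<gamma> (\<lambda>j. \<phi> j x) n) (\<phi> n)"
    if \<phi>: "\<forall>j\<le>N. \<phi> j \<in> L2_fun \<Omega>" for \<phi> :: "nat \<Rightarrow> real^'d \<Rightarrow> real"
  proof -
    have "integrable (lebesgue_on \<Omega>) (\<lambda>x. \<phi> i x \<bullet> \<phi> k x)" if "i \<le> n" "k \<le> n" for i k
      using \<phi> that n by (intro integrable_inner_L2_fun) auto
    then have "1/2 * discr_frac_diff \<alpha> T N \<gamma> (\<lambda>j. L2_inner \<Omega> (\<lambda>x. \<phi> j x) (\<phi> j)) n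
      \<le> L2_inner \<Omega> (\<lambda>x. discr_frac_diff \<alpha> T N \<gamma> (\<lambda>j. \<phi> j x) n) (\<phi> n)
        - 1/2 * discr_frac_diff \<alpha> T N \<gamma> (\<lambda>j. L2_inner \<Omega> (\<lambda>x. \<phi> n x) (\<phi> n)) n"
      by (intro discr_energy_estimate[OF params, where M = "\<lambda>j x u. u"])
        (auto simp: linear_iff inner_commute)
    then show ?thesis
      by (simp add: L2_norm_sq discr_frac_diff_def)
  qed

  have weighted: "1/2 * discr_frac_diff \<alpha> T N \<gamma> (\<lambda>j. (weighted_norm \<Omega> (\<lambda>x. B x (t j)) (\<phi> j))\<^sup>2) n
      \<le> L2_inner \<Omega> (\<lambda>x. discr_frac_diff \<alpha> T N \<gamma> (\<lambda>j. B x (t j) *v \<phi> j x) n) (\<phi> n)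
        - 1/2 * discr_frac_diff \<alpha> T N \<gamma> (\<lambda>j. (weighted_norm \<Omega> (\<lambda>x. B x (t j)) (\<phi> n))\<^sup>2) n"
    if \<phi>: "\<forall>j\<le>N. \<phi> j \<in> L2_fun \<Omega>" for \<phi> :: "nat \<Rightarrow> real^'d \<Rightarrow> real^'d"
  proof -
    have "1/2 * discr_frac_diff \<alpha> T N \<gamma> (\<lambda>j. L2_inner \<Omega> (\<lambda>x. B x (t j) *v \<phi> j x) (\<phi> j)) n
      \<le> L2_inner \<Omega> (\<lambda>x. discr_frac_diff \<alpha> T N \<gamma> (\<lambda>j. B x (t j) *v \<phi> j x) n) (\<phi> n)
        - 1/2 * discr_frac_diff \<alpha> T N \<gamma> (\<lambda>j. L2_inner \<Omega> (\<lambda>x. B x (t j) *v \<phi> n x) (\<phi> n)) n"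
    proof (rule discr_energy_estimate[OF params, where M = "\<lambda>j x. (*v) (B x (t j))"])
      fix j x u v assume "j \<le> n" "x \<in> \<Omega>"
      then show "(B x (t j) *v u) \<bullet> v = (B x (t j) *v v) \<bullet> u"
        using B_symmetric t by (intro symmetric_matrix_inner) auto
    next
      fix j x u assume "j \<le> n" "x \<in> \<Omega>"
      then show "0 \<le> (B x (t j) *v u) \<bullet> u"
        using nonneg[of x j u] by (simp add: inner_commute)
    qed (use \<phi> n in \<open>auto intro!: int\<close>)
    moreover have "discr_frac_diff \<alpha> T N \<gamma> (\<lambda>j. (weighted_norm \<Omega> (\<lambda>x. B x (t j)) (\<psi> j))\<^sup>2) n
      = discr_frac_diff \<alpha> T N \<gamma> (\<lambda>j. L2_inner \<Omega> (\<lambda>x. B x (t j) *v \<psi> j x) (\<psi> j)) n"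
      for \<psi> :: "nat \<Rightarrow> real^'d \<Rightarrow> real^'d"
      by (rule discr_frac_diff_cong) (rule wn)
    ultimately show ?thesis
      by simp
  qed

  have shift: "discr_frac_diff \<alpha> T N \<gamma> f n = (\<Sum>j=0..n-1. K n (j + 1) * (f (j + 1) - f j))"
    for f :: "nat \<Rightarrow> real"
    unfolding discr_frac_diff_def K_def
    by (rule sum.reindex_bij_witness[of _ "\<lambda>j. j + 1" "\<lambda>j. j - 1"]) (use n in auto)

  \<comment> \<open>With \<open>\<phi>\<^sub>n\<close> in place of \<open>\<psi>\<close> this is the contribution of the time dependence of \<open>B\<close>; the
    factor \<open>1/2\<close> is applied at the end.\<close>
  have drift: "- discr_frac_diff \<alpha> T N \<gamma> (\<lambda>j. (weighted_norm \<Omega> (\<lambda>x. B x (t j)) \<psi>)\<^sup>2) n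
      \<le> L * t n powr (1 - \<alpha>) / (\<beta>\<^sub>0 * Gamma (2 - \<alpha>)) * (weighted_norm \<Omega> (\<lambda>x. B x (t n)) \<psi>)\<^sup>2"
    if lip: "lipschitz_in_time \<Omega> T B L" and \<psi>: "\<psi> \<in> L2_fun \<Omega>" for L \<psi>
  proof -
    define W where "W j = (weighted_norm \<Omega> (\<lambda>x. B x (t j)) \<psi>)\<^sup>2" for j
    have "W (j - 1) - W j \<le> L * (t j - t (j - 1)) / \<beta>\<^sub>0 * W n" if j: "j \<in> {1..n}" for j
    proof -
      have "t (j - 1) \<le> t j"
        unfolding t_def by (rule mesh_le[OF T gamma N]) simp
      moreover have "Linf_norm \<Omega> (\<lambda>x. B x (t j) - B x (t (j - 1)))
          \<le> ereal (L * \<bar>t j - t (j - 1)\<bar>)"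
        using lip t[of j] t[of "j - 1"] j unfolding lipschitz_in_time_def by auto
      ultimately have "Linf_norm \<Omega> (\<lambda>x. B x (t j) - B x (t (j - 1)))
          \<le> ereal (L * (t j - t (j - 1)))"
        by simp
      then have "L2_inner \<Omega> (\<lambda>x. B x (t (j - 1)) *v \<psi> x) \<psi> - L2_inner \<Omega> (\<lambda>x. B x (t j) *v \<psi> x) \<psi>
        \<le> L * (t j - t (j - 1)) / \<beta>\<^sub>0 * L2_inner \<Omega> (\<lambda>x. B x (t n) *v \<psi> x) \<psi>"
        by (rule L2_inner_diff_le_weighted)
          (use j \<psi> B_bounds t[of n] B_bounds_pos in \<open>auto intro!: int\<close>)
      then show ?thesis
        using wn[of j \<psi>] wn[of "j - 1" \<psi>] wn[of n \<psi>] j by (auto simp: W_def)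
    qed
    then have "(\<Sum>j=1..n. K n j * (W (j - 1) - W j))
      \<le> (\<Sum>j=1..n. K n j * (L * (t j - t (j - 1)) / \<beta>\<^sub>0 * W n))"
      unfolding K_def using K_coeff_nonneg[OF alpha(2) T gamma N]
      by (intro sum_mono mult_left_mono) auto
    also have "\<dots> = L / \<beta>\<^sub>0 * W n * (\<Sum>j=1..n. K n j * (t j - t (j - 1)))"
      by (simp add: sum_distrib_left mult_ac)
    also have "\<dots> = L * t n powr (1 - \<alpha>) / (\<beta>\<^sub>0 * Gamma (2 - \<alpha>)) * W n"
      unfolding K_def t_def sum_K_coeff_increments[OF alpha(2) T gamma N] by simp
    finally have "(\<Sum>j=1..n. K n j * (W (j - 1) - W j))
      \<le> L * t n powr (1 - \<alpha>) / (\<beta>\<^sub>0 * Gamma (2 - \<alpha>)) * W n" .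
    moreover have "- discr_frac_diff \<alpha> T N \<gamma> W n = (\<Sum>j=1..n. K n j * (W (j - 1) - W j))"
      by (simp add: discr_frac_diff_def K_def sum_negf[symmetric] algebra_simps)
    ultimately show ?thesis
      by (simp add: W_def[abs_def])
  qed

  have lipschitz: "1/2 * discr_frac_diff \<alpha> T N \<gamma> (\<lambda>j. (weighted_norm \<Omega> (\<lambda>x. B x (t j)) (\<phi> j))\<^sup>2) n
      \<le> L2_inner \<Omega> (\<lambda>x. discr_frac_diff \<alpha> T N \<gamma> (\<lambda>j. B x (t j) *v \<phi> j x) n) (\<phi> n)
        + L * t n powr (1 - \<alpha>) / (2 * \<beta>\<^sub>0 * Gamma (2 - \<alpha>))
          * (weighted_norm \<Omega> (\<lambda>x. B x (t n)) (\<phi> n))\<^sup>2"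
    if "lipschitz_in_time \<Omega> T B L" and \<phi>: "\<forall>j\<le>N. \<phi> j \<in> L2_fun \<Omega>"
    for L and \<phi> :: "nat \<Rightarrow> real^'d \<Rightarrow> real^'d"
    using weighted[OF \<phi>] drift[OF that(1), of "\<phi> n"] \<phi> n by simp

  show "(\<forall>\<phi> :: nat \<Rightarrow> real^'d \<Rightarrow> real. (\<forall>j\<le>N. \<phi> j \<in> L2_fun \<Omega>) \<longrightarrow>
          1/2 * discr_frac_diff \<alpha> T N \<gamma> (\<lambda>j. (L2_norm \<Omega> (\<phi> j))\<^sup>2) n
          \<le> L2_inner \<Omega> (\<lambda>x. discr_frac_diff \<alpha> T N \<gamma> (\<lambda>j. \<phi> j x) n) (\<phi> n)) \<and>
       (\<forall>\<phi> :: nat \<Rightarrow> real^'d \<Rightarrow> real^'d. (\<forall>j\<le>N. \<phi> j \<in> L2_fun \<Omega>) \<longrightarrow>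
          1/2 * discr_frac_diff \<alpha> T N \<gamma> (\<lambda>j. (weighted_norm \<Omega> (\<lambda>x. B x (t j)) (\<phi> j))\<^sup>2) n
          \<le> L2_inner \<Omega> (\<lambda>x. discr_frac_diff \<alpha> T N \<gamma> (\<lambda>j. B x (t j) *v \<phi> j x) n) (\<phi> n)
            - 1/2 * (\<Sum>j=0..n-1. K n (j + 1) *
                ((weighted_norm \<Omega> (\<lambda>x. B x (t (j + 1))) (\<phi> n))\<^sup>2
                 - (weighted_norm \<Omega> (\<lambda>x. B x (t j)) (\<phi> n))\<^sup>2))) \<and>
       (\<forall>L\<^sub>B. lipschitz_in_time \<Omega> T B L\<^sub>B \<longrightarrow>
         (\<forall>\<phi> :: nat \<Rightarrow> real^'d \<Rightarrow> real^'d. (\<forall>j\<le>N. \<phi> j \<in> L2_fun \<Omega>) \<longrightarrow>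
          1/2 * discr_frac_diff \<alpha> T N \<gamma> (\<lambda>j. (weighted_norm \<Omega> (\<lambda>x. B x (t j)) (\<phi> j))\<^sup>2) n
          \<le> L2_inner \<Omega> (\<lambda>x. discr_frac_diff \<alpha> T N \<gamma> (\<lambda>j. B x (t j) *v \<phi> j x) n) (\<phi> n)
            + L\<^sub>B * t n powr (1 - \<alpha>) / (2 * \<beta>\<^sub>0 * Gamma (2 - \<alpha>))
              * (weighted_norm \<Omega> (\<lambda>x. B x (t n)) (\<phi> n))\<^sup>2))"
    using scalar weighted lipschitz by (simp add: shift)
qed

end
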